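(* Let $m,n$ be natural numbers (positive integers) with $m\ne 1$ and $n\neq 1$, and let $K_{m,n}$ be the complete bipartite graph with parts of sizes $m$ and $n$. Then: (i) the Randić characteristic polynomial of $K_{m,n}$ is $RP(K_{m,n},\lambda)=\lambda^{m+n-2}(\lambda^2-1)$; (ii) the Randić energy of $K_{m,n}$ is $RE(K_{m,n})=2$.
   Context: All graphs are finite and simple. For a graph $G$ with vertices $v_1,\dots,v_N$ of degrees $d_1,\dots,d_N$, the Randić matrix $R(G)$ is the $N\times N$ real symmetric matrix with $(i,j)$-entry $\frac{1}{\sqrt{d_id_j}}$ if $v_i$ and $v_j$ are adjacent, and $0$ otherwise. The Randić characteristic polynomial of $G$ is $RP(G,\lambda)=\det(\lambda I-R(G))$. The Randić energy of $G$ is $RE(G)=\sum_{i=1}^N|\rho_i|$, where $\rho_1,\dots,\rho_N$ are the eigenvalues of $R(G)$ counted with multiplicity. *)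

theory Defs
  imports "Graph_Theory.Kuratowski" "Jordan_Normal_Form.Char_Poly"
begin

text \<open>
  A finite simple graph is a symmetric, loop-free digraph without parallel arcs (locale
  \<open>graph\<close> of Graph\_Theory); each edge is a pair of opposite arcs, so \<^const>\<open>out_degree\<close> is
  the degree. The list \<open>vs\<close> below is the enumeration \<open>v\<^sub>1, \<dots>, v\<^sub>N\<close> of the vertices.
\<close>

definition vertex_enum :: "('a, 'b) pre_digraph \<Rightarrow> 'a list \<Rightarrow> bool" where
  "vertex_enum G vs \<longleftrightarrow> distinct vs \<and> set vs = verts G"

definition randic_matrix :: "('a, 'b) pre_digraph \<Rightarrow> 'a list \<Rightarrow> real mat" where
  "randic_matrix G vs = mat (length vs) (length vs) (\<lambda>(i, j).
     if vs ! i \<rightarrow>\<^bsub>G\<^esub> vs ! j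
     then 1 / sqrt (real (out_degree G (vs ! i)) * real (out_degree G (vs ! j)))
     else 0)"

definition randic_char_poly :: "('a, 'b) pre_digraph \<Rightarrow> 'a list \<Rightarrow> real poly" where
  "randic_char_poly G vs = char_poly (randic_matrix G vs)"

text \<open>
  The matrix is real symmetric, so all its eigenvalues are real; each is counted with its
  multiplicity as a root of the characteristic polynomial.
\<close>

definition randic_energy :: "('a, 'b) pre_digraph \<Rightarrow> 'a list \<Rightarrow> real" where
  "randic_energy G vs =
     (\<Sum>\<rho> | eigenvalue (randic_matrix G vs) \<rho>.
        real (Polynomial.order \<rho> (char_poly (randic_matrix G vs))) * \<bar>\<rho>\<bar>)"

end

theory Submission
  imports Defs
begin

text \<open>
  For every ordering of the vertices, the Randic matrix of \<open>K\<^sub>m\<^sub>,\<^sub>n\<close> is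
  \<open>(u w\<^sup>T + w u\<^sup>T) / sqrt (m n)\<close>, where \<open>u\<close> and \<open>w\<close> are the indicator vectors of the two parts.
  So it factors as \<open>P Q\<close> through a 2-dimensional space, and \<open>Q P\<close> is the matrix with zero
  diagonal and off-diagonal entries \<open>n / sqrt (m n)\<close> and \<open>m / sqrt (m n)\<close>, whose characteristic
  polynomial is \<open>\<lambda>\<^sup>2 - 1\<close>. Sylvester's identity transfers it to \<open>P Q\<close>.
\<close>

text \<open>Evaluating the determinant of one block matrix in two ways links \<open>P * Q\<close> to
  \<open>Q * P\<close>. Keeping a power of the indeterminate on each side avoids both division and a
  comparison of \<open>n\<close> with \<open>k\<close>.\<close>

lemma char_poly_mult_swap:
  fixes P Q :: "'a :: idom mat"
  assumes P: "P \<in> carrier_mat n k" and Q: "Q \<in> carrier_mat k n"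
  shows "[:0, 1:] ^ k * char_poly (P * Q) = [:0, 1:] ^ n * char_poly (Q * P)"
proof -
  define x :: "'a poly" where "x = [:0, 1:]"
  \<comment> \<open>Lifting the entries to constant polynomials lets them share a block matrix with
    \<open>x\<close>.\<close>
  define p where "p = map_mat (\<lambda>a. [:a:]) P"
  define q where "q = map_mat (\<lambda>a. [:a:]) Q"
  have pc: "p \<in> carrier_mat n k" and qc: "q \<in> carrier_mat k n"
    using P Q by (auto simp: p_def q_def)
  have PQ: "char_poly (P * Q) = det (x \<cdot>\<^sub>m 1\<^sub>m n + - (p * q))"
    unfolding char_poly_defs p_def q_def map_poly_mult(1)[OF P Q, symmetric] x_def
    using P Q by (intro arg_cong[where f = det] eq_matI) auto
  have QP: "char_poly (Q * P) = det (x \<cdot>\<^sub>m 1\<^sub>m k + - (q * p))"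
    unfolding char_poly_defs p_def q_def map_poly_mult(1)[OF Q P, symmetric] x_def
    using P Q by (intro arg_cong[where f = det] eq_matI) auto
  \<comment> \<open>Multiplying \<open>M\<close> by \<open>L\<close> on the right or by
    \<open>L'\<close> on the left clears its lower left block and leaves the Schur complement
    \<open>x I - p q\<close> or \<open>x I - q p\<close>. The second elimination would need
    \<open>q / x\<close>; since \<open>x\<close> has no inverse among polynomials, \<open>L'\<close>
    also scales the lower rows by \<open>x\<close>, whence \<open>det L' = x ^ k\<close>.\<close>
  define M where "M = four_block_mat (x \<cdot>\<^sub>m 1\<^sub>m n) p q (1\<^sub>m k)"
  define L where "L = four_block_mat (1\<^sub>m n) (0\<^sub>m n k) (- q) (1\<^sub>m k)"
  define L' where "L' = four_block_mat (1\<^sub>m n) (0\<^sub>m n k) (- q) (x \<cdot>\<^sub>m 1\<^sub>m k)"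
  have carr: "M \<in> carrier_mat (n + k) (n + k)" "L \<in> carrier_mat (n + k) (n + k)"
    "L' \<in> carrier_mat (n + k) (n + k)"
    by (auto simp: M_def L_def L'_def)
  have "M * L = four_block_mat (x \<cdot>\<^sub>m 1\<^sub>m n + - (p * q)) p (0\<^sub>m k n) (1\<^sub>m k)"
    unfolding M_def L_def using pc qc
    by (subst mult_four_block_mat[of _ n n _ k _ k _ _ n _ k]) auto
  then have "det (M * L) = char_poly (P * Q)"
    using pc qc by (simp add: PQ det_four_block_mat_lower_left_zero[of _ n _ k])
  moreover have "det L = 1"
    unfolding L_def using qc by (subst det_four_block_mat_upper_right_zero[of _ n _ k]) auto
  ultimately have M: "det M = char_poly (P * Q)"
    using det_mult[OF carr(1,2)] by simp
  have "- q * (x \<cdot>\<^sub>m 1\<^sub>m n) + x \<cdot>\<^sub>m 1\<^sub>m k * q = 0\<^sub>m k n"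
    using qc by (intro eq_matI) (auto simp: mult_smult_assoc_mat[of _ k k] mult_smult_distrib[of _ k n])
  moreover have "- q * p + x \<cdot>\<^sub>m 1\<^sub>m k * 1\<^sub>m k = x \<cdot>\<^sub>m 1\<^sub>m k + - (q * p)"
    using pc qc by (intro eq_matI) auto
  ultimately have "L' * M = four_block_mat (x \<cdot>\<^sub>m 1\<^sub>m n) p (0\<^sub>m k n) (x \<cdot>\<^sub>m 1\<^sub>m k + - (q * p))"
    unfolding M_def L'_def using pc qc
    by (subst mult_four_block_mat[of _ n n _ k _ k _ _ n _ k]) auto
  then have "det (L' * M) = x ^ n * char_poly (Q * P)"
    using pc qc by (simp add: QP det_four_block_mat_lower_left_zero[of _ n _ k])
  moreover have "det L' = x ^ k"
    unfolding L'_def using qc by (subst det_four_block_mat_upper_right_zero[of _ n _ k]) auto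
  ultimately show ?thesis
    using det_mult[OF carr(3,1)] M by (simp add: x_def)
qed

lemma char_poly_anti_diagonal_2:
  fixes a b :: "'a :: comm_ring_1"
  assumes A: "A \<in> carrier_mat 2 2"
    and entries: "A $$ (0, 0) = 0" "A $$ (0, 1) = a" "A $$ (1, 0) = b" "A $$ (1, 1) = 0"
  shows "char_poly A = [:0, 1:] ^ 2 - [:a * b:]"
proof -
  have "char_poly_matrix A \<in> carrier_mat 2 2"
    using A by simp
  from laplace_expansion_row[OF this, of 0] show ?thesis
    using A entries
    by (simp add: char_poly_defs numeral_2_eq_2 cofactor_def mat_delete_def det_single)
qed

text \<open>Without parallel arcs, an arc leaving \<open>v\<close> is determined by its head.
  Degrees can then be read off from \<open>arcs_ends\<close>.\<close>

lemma (in nomulti_digraph) out_degree_eq_card_dominated: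
  "out_degree G v = card {w. v \<rightarrow>\<^bsub>G\<^esub> w}"
proof -
  have "inj_on (head G) (out_arcs G v)"
    by (auto intro!: inj_onI no_multi_arcs simp: arc_to_ends_def)
  moreover have "head G ` out_arcs G v = {w. v \<rightarrow>\<^bsub>G\<^esub> w}"
    by (auto simp: arcs_ends_def arc_to_ends_def)
  ultimately show ?thesis
    unfolding out_degree_def by (metis card_image)
qed

lemma sum_indicator_nth:
  assumes "distinct xs" "A \<subseteq> set xs"
  shows "(\<Sum>i<length xs. if xs ! i \<in> A then 1 else 0) = (of_nat (card A) :: 'a :: semiring_1)"
proof -
  have "(\<Sum>i<length xs. if xs ! i \<in> A then 1 else 0) = (\<Sum>x\<in>set xs. if x \<in> A then 1 else 0 :: 'a)"
    by (rule sum.reindex_bij_betw[OF bij_betw_nth]) (use assms in auto)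
  also have "\<dots> = of_nat (card (set xs \<inter> A))"
    by (simp flip: sum.inter_restrict)
  also have "set xs \<inter> A = A"
    using assms by auto
  finally show ?thesis .
qed

lemma randic_char_poly_complete_bipartite:
  assumes "m > 0" "n > 0" and G: "complete_bipartite_digraph m n G" and vs: "vertex_enum G vs"
  shows "randic_char_poly G vs = [:0, 1:] ^ (m + n - 2) * ([:0, 1:] ^ 2 - 1)"
proof -
  from G interpret graph G
    by (simp add: complete_bipartite_digraph_def)
  from G obtain U V where UV: "verts G = U \<union> V" "U \<inter> V = {}" "card U = m" "card V = n"
    and ends: "arcs_ends G = U \<times> V \<union> V \<times> U"
    by (auto simp: complete_bipartite_digraph_def)
  have dist: "distinct vs" and set: "set vs = U \<union> V"
    using vs UV by (auto simp: vertex_enum_def)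
  let ?N = "length vs"
  have fin: "finite U" "finite V"
    using finite_verts UV by auto
  have N: "?N = m + n"
    using distinct_card[OF dist] set UV fin by (simp add: card_Un_disjoint)
  have degU: "out_degree G v = n" if "v \<in> U" for v
  proof -
    have "{w. v \<rightarrow>\<^bsub>G\<^esub> w} = V" using that ends UV by auto
    then show ?thesis using UV by (simp add: out_degree_eq_card_dominated)
  qed
  have degV: "out_degree G v = m" if "v \<in> V" for v
  proof -
    have "{w. v \<rightarrow>\<^bsub>G\<^esub> w} = U" using that ends UV by auto
    then show ?thesis using UV by (simp add: out_degree_eq_card_dominated)
  qed
  define s where "s = sqrt (real m * real n)"
  define u where "u i = (if vs ! i \<in> U then 1 else 0 :: real)" for i
  define w where "w i = (if vs ! i \<in> V then 1 else 0 :: real)" for i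
  \<comment> \<open>The columns of \<open>P\<close> are \<open>u\<close>, \<open>w\<close> and the
    rows of \<open>Q\<close> are \<open>w\<close>, \<open>u\<close> in this swapped order, so that
    the product pairs opposite parts. The whole factor \<open>1 / s\<close> sits in
    \<open>Q\<close>.\<close>
  define P where "P = mat ?N 2 (\<lambda>(i, j). if j = 0 then u i else w i)"
  define Q where "Q = mat 2 ?N (\<lambda>(i, j). (if i = 0 then w j else u j) / s)"
  have s: "s * s = real m * real n" "s > 0"
    using assms by (simp_all add: s_def)
  have P: "P \<in> carrier_mat ?N 2" and Q: "Q \<in> carrier_mat 2 ?N"
    by (simp_all add: P_def Q_def)
  have "randic_matrix G vs = P * Q"
  proof (rule eq_matI)
    fix i j assume "i < dim_row (P * Q)" "j < dim_col (P * Q)"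
    then have ij: "i < ?N" "j < ?N" using P Q by auto
    then have "vs ! i \<in> U \<union> V" "vs ! j \<in> U \<union> V" using set nth_mem by blast+
    moreover have "(P * Q) $$ (i, j) = (u i * w j + w i * u j) / s"
      using ij by (simp add: P_def Q_def scalar_prod_def numeral_2_eq_2 add_divide_distrib)
    \<comment> \<open>Two indices in the same part give 0 on both sides; indices in opposite parts
      have degrees \<open>n\<close> and \<open>m\<close>, and the entry is
      \<open>1 / s\<close>.\<close>
    ultimately show "randic_matrix G vs $$ (i, j) = (P * Q) $$ (i, j)"
      using ij UV(2) by (auto simp: randic_matrix_def ends u_def w_def degU degV s_def mult.commute)
  qed (simp_all add: randic_matrix_def P_def Q_def)
  then have "[:0, 1:] ^ 2 * randic_char_poly G vs = [:0, 1:] ^ ?N * char_poly (Q * P)"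
    using char_poly_mult_swap[OF P Q] by (simp add: randic_char_poly_def)
  also have "char_poly (Q * P) = [:0, 1:] ^ 2 - [:(real n / s) * (real m / s):]"
  proof (rule char_poly_anti_diagonal_2)
    show "Q * P \<in> carrier_mat 2 2" using P Q by simp
    \<comment> \<open>The supports of \<open>u\<close> and \<open>w\<close> are disjoint, which
      kills the diagonal of \<open>Q * P\<close>; the values are 0 or 1, so the off-diagonal sums of
      squares just count the parts.\<close>
    have uw: "u i * w i = 0" "w i * u i = 0" "u i * u i = u i" "w i * w i = w i" for i
      using UV(2) by (auto simp: u_def w_def)
    have sums: "(\<Sum>i<?N. u i) = m" "(\<Sum>i<?N. w i) = n"
      unfolding u_def w_def using sum_indicator_nth[OF dist, where 'a = real] set UV by simp_all
    have QP: "(Q * P) $$ (i, j) = (\<Sum>k<?N. (if i = 0 then w k else u k) * (if j = 0 then u k else w k)) / s"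
      if "i < 2" "j < 2" for i j
      using that by (simp add: P_def Q_def scalar_prod_def sum_divide_distrib lessThan_atLeast0)
    show "(Q * P) $$ (0, 0) = 0" "(Q * P) $$ (0, 1) = real n / s"
      "(Q * P) $$ (1, 0) = real m / s" "(Q * P) $$ (1, 1) = 0"
      by (simp_all add: QP uw sums)
  qed
  also have "(real n / s) * (real m / s) = 1"
    using s assms by (simp add: mult.commute)
  \<comment> \<open>Both parts are nonempty, so \<open>m + n - 2\<close> is not truncated; the
    factor \<open>[:0, 1:] ^ 2\<close> then cancels against the one from the swap identity.\<close>
  also have "[:0, 1:] ^ ?N = [:0, 1:] ^ 2 * ([:0, 1:] ^ (m + n - 2) :: real poly)"
    unfolding N power_add[symmetric] using assms by (intro arg_cong[where f = "power _"]) simp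
  finally show ?thesis
    by (simp add: mult.assoc flip: one_pCons)
qed

text \<open>The factor \<open>x^2 - 1\<close> contributes the simple eigenvalues 1 and -1, and any
  other eigenvalue is 0.\<close>

lemma randic_energy_complete_bipartite:
  assumes "m > 0" "n > 0" and "complete_bipartite_digraph m n G" and "vertex_enum G vs"
  shows "randic_energy G vs = 2"
proof -
  define p where "p = char_poly (randic_matrix G vs)"
  have "randic_matrix G vs \<in> carrier_mat (length vs) (length vs)"
    by (simp add: randic_matrix_def)
  then have eig: "{\<rho>. eigenvalue (randic_matrix G vs) \<rho>} = {\<rho>. poly p \<rho> = 0}"
    by (simp add: p_def eigenvalue_root_char_poly)
  have p: "p = [:0, 1:] ^ (m + n - 2) * ([:-1, 1:] * [:1, 1:])"
    using randic_char_poly_complete_bipartite[OF assms]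
    by (simp add: p_def randic_char_poly_def power2_eq_square one_pCons)
  have "p \<noteq> 0"
    unfolding p by (intro no_zero_divisors power_not_zero) simp_all
  have order: "Polynomial.order 1 p = 1" "Polynomial.order (-1) p = 1"
  proof -
    have nz: "[:0, 1:] ^ (m + n - 2) * ([:-1, 1:] * [:1, 1:]) \<noteq> (0 :: real poly)"
      "[:-1, 1:] * [:1, 1:] \<noteq> (0 :: real poly)"
      using \<open>p \<noteq> 0\<close> unfolding p by auto
    have "Polynomial.order 1 [:-1, 1 :: real:] = 1" "Polynomial.order (-1) [:1, 1 :: real:] = 1"
      using order_power_n_n[of "1 :: real" 1] order_power_n_n[of "-1 :: real" 1] by simp_all
    \<comment> \<open>Orders add over products, and at each of the two points only one linear factor
      vanishes.\<close>
    then show "Polynomial.order 1 p = 1" "Polynomial.order (-1) p = 1"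
      unfolding p order_mult[OF nz(1)] order_mult[OF nz(2)] by (simp_all add: order_0I)
  qed
  have "randic_energy G vs = (\<Sum>\<rho> | poly p \<rho> = 0. real (Polynomial.order \<rho> p) * \<bar>\<rho>\<bar>)"
    unfolding randic_energy_def eig p_def ..
  also have "\<dots> = (\<Sum>\<rho>\<in>{1, -1}. real (Polynomial.order \<rho> p) * \<bar>\<rho>\<bar>)"
    using poly_roots_finite[OF \<open>p \<noteq> 0\<close>] by (rule sum.mono_neutral_right) (auto simp: p square_eq_1_iff)
  also have "\<dots> = 2"
    by (simp add: order)
  finally show ?thesis .
qed

theorem theorem5:
  fixes G :: "('a, 'b) pre_digraph" and vs :: "'a list" and m n :: nat
  assumes "m > 0" and "n > 0" and "m \<noteq> 1" and "n \<noteq> 1"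
    and "complete_bipartite_digraph m n G"
    and "vertex_enum G vs"
  shows "randic_char_poly G vs = [:0, 1:] ^ (m + n - 2) * ([:0, 1:] ^ 2 - 1)
       \<and> randic_energy G vs = 2"
  using assms randic_char_poly_complete_bipartite randic_energy_complete_bipartite by blast

end
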